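(* Let $X$ be a complex Banach space, let $A:\operatorname{dom}(A)\subseteq X\to X$ and $B:\operatorname{dom}(B)\subseteq X\to X$ be closed linear operators with $\rho(B)\neq\emptyset$, and let $Y$ be a Banach space continuously embedded in $X$ such that $\operatorname{dom}(A)\subseteq\operatorname{dom}(B^2)\cap Y$, $B(\operatorname{dom}(A))\subseteq Y\subseteq\operatorname{dom}(B)$, and the operator $G=\begin{bmatrix}-B & I \\ A+B^2 & -B\end{bmatrix}$ with domain $\operatorname{dom}(A)\times Y$ generates a $C_0$-group $\{\mathcal T(t)\}_{t\in\mathbb R}$ on $Y\times X$. Then for every $t\in\mathbb R$: (i) $C_{A,B}(t)Y\subseteq Y$; (ii) $C_{A,B}(t)\operatorname{dom}(A)\subseteq\operatorname{dom}(A)$; (iii) $S_{A,B}(t)X\subseteq Y\subseteq\operatorname{dom}(B)$; (iv) $S_{A,B}(t)Y\subseteq\operatorname{dom}(A)$; (v) $AS_{A,B}(t)\operatorname{dom}(A)\subseteq Y\subseteq\operatorname{dom}(B)$.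
   Context: Write $\mathcal T(t)=\begin{bmatrix}T_{11}(t) & T_{12}(t) \\ T_{21}(t) & T_{22}(t)\end{bmatrix}$ in block form with respect to $Y\times X$. The generalized cosine and sine families $C_{A,B}(t)\in\mathcal B(\operatorname{dom}(B),X)$ (graph norm on $\operatorname{dom}(B)$) and $S_{A,B}(t)\in\mathcal B(X)$ are given by $C_{A,B}(t)x=T_{22}(t)x-BT_{12}(t)x+2T_{12}(t)Bx$ for $x\in\operatorname{dom}(B)$ and $S_{A,B}(t)x=T_{12}(t)x$ for $x\in X$. (They represent the mild solutions of $u''+2Bu'=Au$ with data $u(0)=x,u'(0)=0$, respectively $u(0)=0,u'(0)=x$.) *)

theory Defs
  imports "HOL-Analysis.Analysis"
begin

section \<open>Complex normed spaces\<close>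

text \<open>The distribution only provides real normed spaces. The complex scalar multiplication below
  extends the real one, so that the norm, topology and completeness are those of the library.\<close>

class complex_normed_vector = real_normed_vector +
  fixes scaleC :: "complex \<Rightarrow> 'a \<Rightarrow> 'a" (infixr "*\<^sub>C" 75)
  assumes scaleC_add_right: "a *\<^sub>C (x + y) = a *\<^sub>C x + a *\<^sub>C y"
    and scaleC_add_left: "(a + b) *\<^sub>C x = a *\<^sub>C x + b *\<^sub>C x"
    and scaleC_scaleC: "a *\<^sub>C b *\<^sub>C x = (a * b) *\<^sub>C x"
    and scaleC_of_real: "complex_of_real r *\<^sub>C x = r *\<^sub>R x"
    and norm_scaleC: "norm (a *\<^sub>C x) = cmod a * norm x"

class complex_banach = complex_normed_vector + complete_space

subclass (in complex_banach) banach ..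

global_interpretation complex_vector:
  vector_space "scaleC :: complex \<Rightarrow> 'a \<Rightarrow> 'a::complex_normed_vector"
proof
  fix x :: 'a
  show "1 *\<^sub>C x = x"
    using scaleC_of_real[of 1 x] by simp
qed (simp_all add: scaleC_add_right scaleC_add_left scaleC_scaleC)

instantiation complex :: complex_banach
begin

definition scaleC_complex :: "complex \<Rightarrow> complex \<Rightarrow> complex" where
  "scaleC_complex a x = a * x"

instance
  by standard (simp_all add: scaleC_complex_def algebra_simps norm_mult scaleR_conv_of_real)

end

instantiation prod :: (complex_normed_vector, complex_normed_vector) complex_normed_vector
begin

definition scaleC_prod :: "complex \<Rightarrow> 'a \<times> 'b \<Rightarrow> 'a \<times> 'b" where
  "scaleC_prod a z = (a *\<^sub>C fst z, a *\<^sub>C snd z)"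

instance
proof
  fix a b :: complex and r :: real and x y :: "'a \<times> 'b"
  show "a *\<^sub>C (x + y) = a *\<^sub>C x + a *\<^sub>C y"
    by (simp add: scaleC_prod_def scaleC_add_right)
  show "(a + b) *\<^sub>C x = a *\<^sub>C x + b *\<^sub>C x"
    by (simp add: scaleC_prod_def scaleC_add_left)
  show "a *\<^sub>C b *\<^sub>C x = (a * b) *\<^sub>C x"
    by (simp add: scaleC_prod_def scaleC_scaleC)
  show "complex_of_real r *\<^sub>C x = r *\<^sub>R x"
    by (simp add: scaleC_prod_def scaleC_of_real scaleR_prod_def)
  show "norm (a *\<^sub>C x) = cmod a * norm x"
    by (simp add: scaleC_prod_def norm_prod_def norm_scaleC power_mult_distrib
        flip: distrib_left) (simp add: real_sqrt_mult)
qed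

end

instance prod :: (complex_banach, complex_banach) complex_banach ..

definition bounded_clinear ::
    "('a::complex_normed_vector \<Rightarrow> 'b::complex_normed_vector) \<Rightarrow> bool" where
  "bounded_clinear f \<longleftrightarrow> bounded_linear f \<and> Vector_Spaces.linear scaleC scaleC f"


section \<open>Unbounded operators\<close>

text \<open>An operator is given by its domain \<open>D\<close> and a function that is only relevant on \<open>D\<close>.\<close>

definition op_graph :: "'a set \<Rightarrow> ('a \<Rightarrow> 'b) \<Rightarrow> ('a \<times> 'b) set" where
  "op_graph D A = {(x, A x) |x. x \<in> D}"

definition linear_operator ::
    "'a::complex_normed_vector set \<Rightarrow> ('a \<Rightarrow> 'b::complex_normed_vector) \<Rightarrow> bool" where
  "linear_operator D A \<longleftrightarrow> complex_vector.subspace D \<and>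
     (\<forall>x\<in>D. \<forall>y\<in>D. A (x + y) = A x + A y) \<and> (\<forall>c. \<forall>x\<in>D. A (c *\<^sub>C x) = c *\<^sub>C A x)"

definition closed_linear_operator ::
    "'a::complex_normed_vector set \<Rightarrow> ('a \<Rightarrow> 'b::complex_normed_vector) \<Rightarrow> bool" where
  "closed_linear_operator D A \<longleftrightarrow> linear_operator D A \<and> closed (op_graph D A)"

definition resolvent_set ::
    "'a::complex_normed_vector set \<Rightarrow> ('a \<Rightarrow> 'a) \<Rightarrow> complex set" where
  "resolvent_set D A = {\<mu>. \<exists>R. bounded_clinear R \<and>
     (\<forall>x. R x \<in> D \<and> \<mu> *\<^sub>C R x - A (R x) = x) \<and> (\<forall>x\<in>D. R (\<mu> *\<^sub>C x - A x) = x)}"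

definition square_dom :: "'a set \<Rightarrow> ('a \<Rightarrow> 'a) \<Rightarrow> 'a set" where
  "square_dom D B = {x \<in> D. B x \<in> D}"


section \<open>Strongly continuous groups\<close>

definition C0_group :: "(real \<Rightarrow> 'a::complex_normed_vector \<Rightarrow> 'a) \<Rightarrow> bool" where
  "C0_group T \<longleftrightarrow> (\<forall>t. bounded_clinear (T t)) \<and> T 0 = id \<and> (\<forall>s t. T (s + t) = T s \<circ> T t) \<and>
     (\<forall>x. continuous_on UNIV (\<lambda>t. T t x))"

text \<open>The infinitesimal generator, identified with its graph.\<close>

definition generator :: "(real \<Rightarrow> 'a::complex_normed_vector \<Rightarrow> 'a) \<Rightarrow> ('a \<times> 'a) set" where
  "generator T = {(x, y). ((\<lambda>h. (1 / h) *\<^sub>R (T h x - x)) \<longlongrightarrow> y) (at 0)}"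

definition generates_C0_group ::
    "'a::complex_normed_vector set \<Rightarrow> ('a \<Rightarrow> 'a) \<Rightarrow> (real \<Rightarrow> 'a \<Rightarrow> 'a) \<Rightarrow> bool" where
  "generates_C0_group D G T \<longleftrightarrow> C0_group T \<and> generator T = op_graph D G"


section \<open>The block operator and the generalized cosine and sine families\<close>

text \<open>The continuously embedded space \<open>Y\<close> is a type of its own with an embedding \<open>j\<close> into \<open>X\<close>;
  regarded as a subspace of \<open>X\<close> it is \<open>range j\<close>.\<close>

definition continuous_embedding ::
    "('y::complex_normed_vector \<Rightarrow> 'x::complex_normed_vector) \<Rightarrow> bool" where
  "continuous_embedding j \<longleftrightarrow> bounded_clinear j \<and> inj j"

definition G_dom :: "('y \<Rightarrow> 'x) \<Rightarrow> 'x set \<Rightarrow> ('y \<times> 'x) set" where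
  "G_dom j domA = {(y, x). j y \<in> domA \<and> x \<in> range j}"

text \<open>On \<open>G_dom j domA\<close> the first component \<open>x - B (j y)\<close> lies in \<open>range j\<close> as soon as
  \<open>B ` domA \<subseteq> range j\<close>, and \<open>inv j\<close> turns it into an element of \<open>Y\<close>.\<close>

definition G_op ::
    "('y::complex_normed_vector \<Rightarrow> 'x::complex_normed_vector) \<Rightarrow> ('x \<Rightarrow> 'x) \<Rightarrow> ('x \<Rightarrow> 'x) \<Rightarrow>
     'y \<times> 'x \<Rightarrow> 'y \<times> 'x" where
  "G_op j A B = (\<lambda>(y, x). (inv j (- B (j y) + x), (A (j y) + B (B (j y))) - B x))"

definition T12 :: "(real \<Rightarrow> 'y::zero \<times> 'x \<Rightarrow> 'y \<times> 'x) \<Rightarrow> real \<Rightarrow> 'x \<Rightarrow> 'y" where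
  "T12 T t x = fst (T t (0, x))"

definition T22 :: "(real \<Rightarrow> 'y::zero \<times> 'x \<Rightarrow> 'y \<times> 'x) \<Rightarrow> real \<Rightarrow> 'x \<Rightarrow> 'x" where
  "T22 T t x = snd (T t (0, x))"

text \<open>The values of \<open>gen_cos\<close> are only meaningful on the domain of \<open>B\<close>.\<close>

definition gen_cos ::
    "('y::complex_normed_vector \<Rightarrow> 'x::complex_normed_vector) \<Rightarrow> ('x \<Rightarrow> 'x) \<Rightarrow>
     (real \<Rightarrow> 'y \<times> 'x \<Rightarrow> 'y \<times> 'x) \<Rightarrow> real \<Rightarrow> 'x \<Rightarrow> 'x" where
  "gen_cos j B T t x = T22 T t x - B (j (T12 T t x)) + 2 *\<^sub>R j (T12 T t (B x))"

definition gen_sin ::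
    "('y::complex_normed_vector \<Rightarrow> 'x::complex_normed_vector) \<Rightarrow>
     (real \<Rightarrow> 'y \<times> 'x \<Rightarrow> 'y \<times> 'x) \<Rightarrow> real \<Rightarrow> 'x \<Rightarrow> 'x" where
  "gen_sin j T t x = j (T12 T t x)"

end

theory Submission imports Defs begin

text \<open>For \<open>x\<close> in \<open>Y\<close> the vector \<open>(0, x)\<close> lies in the domain of \<open>G\<close>, with
  \<open>G (0, x) = (x, -B x)\<close>. Since \<open>T(t)\<close> preserves the domain of \<open>G\<close> and commutes with \<open>G\<close>, the first
  component of \<open>G T(t) (0, x) = T(t) (x, -B x)\<close> shows that \<open>C(t) x\<close> is the first component of
  \<open>T(t) (x, B x)\<close>, which gives the claims on the cosine family. For \<open>x\<close> in \<open>dom A\<close> the vector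
  \<open>(0, x)\<close> even lies in the domain of \<open>G\<^sup>2\<close>; so with \<open>(p, q) = T(t) (0, x)\<close> the element
  \<open>A p = ((A + B\<^sup>2) p - B q) + B (q - B p)\<close> is a sum of two elements of \<open>Y\<close>.\<close>

text \<open>By the group law \<open>T t\<close> commutes with every \<open>T h\<close>, and being
  bounded it passes through the limit of the difference quotients.\<close>

lemma generator_C0_group_invariant:
  assumes "C0_group T" and "(z, w) \<in> generator T"
  shows "(T t z, T t w) \<in> generator T"
proof -
  have lin: "bounded_linear (T t)"
    using assms(1) by (simp add: C0_group_def bounded_clinear_def)
  interpret bounded_linear "T t" by (fact lin)
  have add: "T s \<circ> T t = T t \<circ> T s" for s
    using assms(1) unfolding C0_group_def by (metis add.commute)
  have "((\<lambda>h. T t ((1 / h) *\<^sub>R (T h z - z))) \<longlongrightarrow> T t w) (at 0)"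
    using assms(2) by (intro tendsto) (simp add: generator_def)
  moreover have "T t ((1 / h) *\<^sub>R (T h z - z)) = (1 / h) *\<^sub>R (T h (T t z) - T t z)" for h
    using fun_cong[OF add, of h z] by (simp add: scaleR diff)
  ultimately show ?thesis by (simp add: generator_def)
qed

lemma generates_C0_group_invariant:
  assumes "generates_C0_group D G T" and "z \<in> D"
  shows "T t z \<in> D" and "G (T t z) = T t (G z)"
proof -
  have "(T t z, T t (G z)) \<in> op_graph D G"
    using assms generator_C0_group_invariant[of T z "G z" t]
    by (auto simp: generates_C0_group_def op_graph_def)
  then show "T t z \<in> D" and "G (T t z) = T t (G z)"
    by (auto simp: op_graph_def)
qed

lemma linear_operator_zero:
  assumes "linear_operator D A"
  shows "0 \<in> D" and "A 0 = 0"
proof -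
  show "0 \<in> D"
    using assms by (simp add: linear_operator_def complex_vector.subspace_0)
  then have "A (0 + 0) = A 0 + A 0"
    using assms unfolding linear_operator_def by blast
  then show "A 0 = 0" by simp
qed

lemma linear_operator_diff:
  assumes "linear_operator D A" and "x \<in> D" and "y \<in> D"
  shows "A (x - y) = A x - A y"
proof -
  have "x - y \<in> D"
    using assms by (simp add: linear_operator_def complex_vector.subspace_diff)
  then have "A (x - y + y) = A (x - y) + A y"
    using assms unfolding linear_operator_def by blast
  then show ?thesis by simp
qed

theorem lemma4p1:
  fixes A B :: "'x::complex_banach \<Rightarrow> 'x"
    and domA domB :: "'x set"
    and j :: "'y::complex_banach \<Rightarrow> 'x"
    and T :: "real \<Rightarrow> 'y \<times> 'x \<Rightarrow> 'y \<times> 'x"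
    and t :: real
  assumes "closed_linear_operator domA A"
    and "closed_linear_operator domB B"
    and "resolvent_set domB B \<noteq> {}"
    and "continuous_embedding j"
    and "domA \<subseteq> square_dom domB B \<inter> range j"
    and "B ` domA \<subseteq> range j"
    and "range j \<subseteq> domB"
    and "generates_C0_group (G_dom j domA) (G_op j A B) T"
  shows "gen_cos j B T t ` range j \<subseteq> range j \<and>
    gen_cos j B T t ` domA \<subseteq> domA \<and>
    (gen_sin j T t ` UNIV \<subseteq> range j \<and> range j \<subseteq> domB) \<and>
    gen_sin j T t ` range j \<subseteq> domA \<and>
    (A ` gen_sin j T t ` domA \<subseteq> range j \<and> range j \<subseteq> domB)"
proof -
  have linA: "linear_operator domA A" and linB: "linear_operator domB B"
    using assms(1,2) by (simp_all add: closed_linear_operator_def)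
  have group: "generates_C0_group (G_dom j domA) (G_op j A B) T" by (fact assms(8))
  interpret j: bounded_linear j
    using assms(4) by (simp add: continuous_embedding_def bounded_clinear_def)
  interpret T: bounded_linear "T t"
    using group by (simp add: generates_C0_group_def C0_group_def bounded_clinear_def)
  have inj: "inj j"
    using assms(4) by (simp add: continuous_embedding_def)
  \<comment> \<open>\<open>inv j\<close> is undone by \<open>j\<close> only on
    \<open>range j\<close>; the difference stays there by linearity, so the first component of
    \<open>G_op\<close> can be read in X.\<close>
  have j_inv_diff: "j (inv j (- u + v)) = v - u" if "u \<in> range j" "v \<in> range j" for u v
    using that by (auto simp: f_inv_into_f simp flip: j.diff)
  have add_Y: "u + v \<in> range j" if "u \<in> range j" "v \<in> range j" for u v
    using that by (auto simp flip: j.add)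
  have dom0: "(0, x) \<in> G_dom j domA" if "x \<in> range j" for x
    using that linear_operator_zero[OF linA] by (simp add: G_dom_def j.zero)
  have G0: "G_op j A B (0, j y) = (y, - B (j y))" for y
    using linear_operator_zero(2)[OF linA] linear_operator_zero(2)[OF linB] inj
    by (simp add: G_op_def j.zero)

  have cos: "gen_cos j B T t (j y) = j (fst (T t (y, B (j y))))" for y
  proof -
    obtain p q where pq: "T t (0, j y) = (p, q)" by fastforce
    have "(p, q) \<in> G_dom j domA"
      using generates_C0_group_invariant(1)[OF group dom0, of "j y" t] pq by simp
    then have "j p \<in> domA" "q \<in> range j" by (auto simp: G_dom_def)
    have "G_op j A B (p, q) = T t (y, - B (j y))"
      using generates_C0_group_invariant(2)[OF group dom0, of "j y" t] pq by (simp add: G0)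
    then have "inv j (- B (j p) + q) = fst (T t (y, - B (j y)))"
      by (simp add: G_op_def prod_eq_iff)
    \<comment> \<open>The left side is \<open>T22\<close> minus \<open>B\<close> applied to
      \<open>T12\<close>, the first two terms of \<open>gen_cos\<close> at
      \<open>j y\<close>.\<close>
    then have 1: "q - B (j p) = j (fst (T t (y, - B (j y))))"
      using j_inv_diff[of "B (j p)" q] \<open>j p \<in> domA\<close> \<open>q \<in> range j\<close> assms(6) by auto
    \<comment> \<open>The remaining term of \<open>gen_cos\<close>, twice \<open>T12\<close> at
      \<open>B (j y)\<close>, is exactly what turns \<open>- B (j y)\<close> into
      \<open>B (j y)\<close> in the second slot.\<close>
    have "T t (y, B (j y)) = T t ((y, - B (j y)) + 2 *\<^sub>R (0, B (j y)))"
      by (simp add: scaleR_2)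
    also have "\<dots> = T t (y, - B (j y)) + 2 *\<^sub>R T t (0, B (j y))"
      by (simp only: T.add T.scaleR)
    finally have "j (fst (T t (y, B (j y)))) =
        j (fst (T t (y, - B (j y)))) + 2 *\<^sub>R j (fst (T t (0, B (j y))))"
      by (simp add: j.add j.scaleR)
    then show ?thesis
      using 1 pq by (simp add: gen_cos_def T12_def T22_def)
  qed

  have cos_dom: "gen_cos j B T t x \<in> domA" if "x \<in> domA" for x
  proof -
    obtain y where x: "x = j y" using \<open>x \<in> domA\<close> assms(5) by blast
    \<comment> \<open>For \<open>x\<close> in \<open>domA\<close> the new initial vector lies in the
      domain of G, so invariance puts its first component back in \<open>domA\<close>.\<close>
    have "(y, B (j y)) \<in> G_dom j domA"
      using that x assms(6) by (auto simp: G_dom_def)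
    then have "T t (y, B (j y)) \<in> G_dom j domA"
      by (rule generates_C0_group_invariant(1)[OF group])
    then show ?thesis by (auto simp: x cos G_dom_def split: prod.splits)
  qed

  have sin_dom: "gen_sin j T t x \<in> domA" if "x \<in> range j" for x
    using generates_C0_group_invariant(1)[OF group dom0[OF that], of t]
    by (auto simp: gen_sin_def T12_def G_dom_def split: prod.splits)

  have A_sin: "A (gen_sin j T t x) \<in> range j" if "x \<in> domA" for x
  proof -
    obtain y where x: "x = j y" using \<open>x \<in> domA\<close> assms(5) by blast
    obtain p q where pq: "T t (0, x) = (p, q)" by fastforce
    have "(p, q) \<in> G_dom j domA"
      using generates_C0_group_invariant(1)[OF group dom0, of x t] pq x by simp
    then have p: "j p \<in> domA" and q: "q \<in> range j" by (auto simp: G_dom_def)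
    have "- B x \<in> range j"
      using that assms(6) by (auto simp flip: j.neg)
    \<comment> \<open>This vector is G applied to \<open>(0, x)\<close>, so \<open>(0, x)\<close> is
      in the domain of the square of G.\<close>
    then have "(y, - B (j y)) \<in> G_dom j domA"
      using that by (simp add: G_dom_def x)
    then have "T t (y, - B (j y)) \<in> G_dom j domA"
      by (rule generates_C0_group_invariant(1)[OF group])
    moreover have "G_op j A B (p, q) = T t (y, - B (j y))"
      using generates_C0_group_invariant(2)[OF group dom0, of "j y" t] pq x by (simp add: G0)
    ultimately have "G_op j A B (p, q) \<in> G_dom j domA" by simp
    then have Bp_q: "j (inv j (- B (j p) + q)) \<in> domA"
      and r: "A (j p) + B (B (j p)) - B q \<in> range j"
      by (simp_all add: G_op_def G_dom_def)
    have Bp: "B (j p) \<in> range j" using p assms(6) by auto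
    \<comment> \<open>Neither \<open>q\<close> nor \<open>B (j p)\<close> need be in
      \<open>domA\<close>; their difference is, as the first component of a vector in the domain of
      G.\<close>
    then have "q - B (j p) \<in> domA" using Bp_q q j_inv_diff by simp
    then have "B (q - B (j p)) \<in> range j" using assms(6) by auto
    moreover have "B (q - B (j p)) = B q - B (B (j p))"
      using linear_operator_diff[OF linB] q Bp assms(7) by blast
    \<comment> \<open>Adding this to \<open>r\<close> cancels both \<open>B q\<close> and
      \<open>B (B (j p))\<close>.\<close>
    ultimately have "A (j p) \<in> range j" using add_Y[OF r, of "B q - B (B (j p))"] by simp
    then show ?thesis by (simp add: gen_sin_def T12_def pq)
  qed

  show ?thesis
    using cos cos_dom sin_dom A_sin assms(7) by (auto simp: gen_sin_def)
qed

end
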